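(* (In $\mathsf{ZFC}$.) The space $\nabla(\omega_2+1)^\omega$ is not hereditarily normal.
   Context: The ordinal $\omega_2+1$ has the order topology. For a space $X$, the box product $\square X^\omega$ is $X^\omega$ with base all $\prod_nU_n$, $U_n$ open in $X$; $x\sim y$ iff $\{n:x(n)\ne y(n)\}$ is finite; $\nabla X^\omega$ is the quotient space $\square X^\omega/\sim$. A space is hereditarily normal if every subspace is normal. *)

theory Defs
  imports "HOL-Analysis.Analysis"
begin

section \<open>The ordinal \<open>\<omega>\<^sub>2 + 1\<close> with its order topology\<close>

text \<open>Ordinals are represented by well-orders, given as (reflexive) relations.
  As initial ordinals, \<open>\<omega>\<^sub>1\<close> and \<open>\<omega>\<^sub>2\<close> are the cardinal successors of
  \<open>\<omega>\<close> and \<open>\<omega>\<^sub>1\<close>; \<^const>\<open>cardSuc\<close> is unique up to order isomorphism.\<close>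

definition omega1 :: "nat set rel"
  where "omega1 = cardSuc natLeq"

definition omega2 :: "nat set set rel"
  where "omega2 = cardSuc omega1"

text \<open>The successor ordinal: \<^const>\<open>None\<close> is a new point on top of \<open>r\<close>.\<close>

definition ord_succ :: "'a rel \<Rightarrow> 'a option rel"
  where "ord_succ r =
    {(Some a, Some b) | a b. (a, b) \<in> r} \<union> {(x, None) | x. x \<in> insert None (Some ` Field r)}"

text \<open>The open rays form a subbase; the whole field is added for the degenerate case
  of a one-point order, which has no nonempty open ray.\<close>

definition order_topology_of :: "'a rel \<Rightarrow> 'a topology"
  where "order_topology_of r =
    topology_generated_by (insert (Field r) (underS r ` Field r \<union> aboveS r ` Field r))"

lemma Field_ord_succ: "Field (ord_succ r) = insert None (Some ` Field r)"
proof (intro equalityI subsetI)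
  fix x assume "x \<in> Field (ord_succ r)"
  then show "x \<in> insert None (Some ` Field r)"
    by (auto simp: ord_succ_def Field_def)
next
  fix x assume "x \<in> insert None (Some ` Field r)"
  then have "(x, None) \<in> ord_succ r"
    by (auto simp: ord_succ_def)
  then show "x \<in> Field (ord_succ r)"
    by (rule FieldI1)
qed

lemma topspace_order_topology_of [simp]: "topspace (order_topology_of r) = Field r"
  by (auto simp: order_topology_of_def underS_def aboveS_def Field_def)

lemma Card_order_omega2: "Card_order omega1" "Card_order omega2"
  and less_omega2: "(natLeq, omega1) \<in> ordLess" "(omega1, omega2) \<in> ordLess"
  by (simp_all add: omega1_def omega2_def natLeq_Card_order cardSuc_Card_order cardSuc_greater)

lemma Well_order_ord_succ:
  assumes "Well_order r"
  shows "Well_order (ord_succ r)"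
proof -
  have lin: "Linear_order r" and wf: "wf (r - Id)"
    using assms by (auto simp: well_order_on_def)
  have F: "a \<in> Field r" "b \<in> Field r" if "(a, b) \<in> r" for a b
    using that by (auto simp: Field_def)
  have refl: "(a, a) \<in> r" if "a \<in> Field r" for a
    using lin that unfolding order_on_defs refl_on_def by blast
  have tr: "(a, c) \<in> r" if "(a, b) \<in> r" "(b, c) \<in> r" for a b c
    using lin that unfolding order_on_defs trans_def by blast
  have anti: "a = b" if "(a, b) \<in> r" "(b, a) \<in> r" for a b
    using lin that unfolding order_on_defs antisym_def by blast
  have tot: "(a, b) \<in> r \<or> (b, a) \<in> r" if "a \<in> Field r" "b \<in> Field r" for a b
  proof (cases "a = b")
    case True
    then show ?thesis
      using refl that by simp
  next
    case False
    have "Total r"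
      using lin by (simp add: order_on_defs)
    then show ?thesis
      using False that by (simp add: total_on_def)
  qed
  have succ: "(Some a, Some b) \<in> ord_succ r \<longleftrightarrow> (a, b) \<in> r"
    "(Some a, None) \<in> ord_succ r \<longleftrightarrow> a \<in> Field r"
    "(None, None) \<in> ord_succ r" "(None, Some a) \<notin> ord_succ r" for a b
    by (auto simp: ord_succ_def)
  have "refl_on (Field (ord_succ r)) (ord_succ r)"
    unfolding refl_on_def Field_ord_succ using refl by (auto simp: succ)
  moreover have "ord_succ r \<subseteq> Field (ord_succ r) \<times> Field (ord_succ r)"
    by (auto intro: FieldI1 FieldI2)
  moreover have "trans (ord_succ r)"
  proof (rule transI)
    fix x y z assume "(x, y) \<in> ord_succ r" "(y, z) \<in> ord_succ r"
    then show "(x, z) \<in> ord_succ r"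
      by (cases x; cases y; cases z) (auto simp: succ intro: tr F)
  qed
  moreover have "antisym (ord_succ r)"
  proof (rule antisymI)
    fix x y assume "(x, y) \<in> ord_succ r" "(y, x) \<in> ord_succ r"
    then show "x = y"
      by (cases x; cases y) (auto simp: succ intro: anti)
  qed
  moreover have "total_on (Field (ord_succ r)) (ord_succ r)"
    unfolding total_on_def Field_ord_succ using tot by (auto simp: succ)
  ultimately have "Linear_order (ord_succ r)"
    unfolding order_on_defs by blast
  moreover have "wf (ord_succ r - Id)"
  proof (rule wfUNIVI)
    fix P :: "'a option \<Rightarrow> bool" and x
    assume step: "\<forall>x. (\<forall>y. (y, x) \<in> ord_succ r - Id \<longrightarrow> P y) \<longrightarrow> P x"
    have S: "P (Some a)" for a
      using wf
    proof (induction a rule: wf_induct_rule)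
      case (less a)
      then show ?case
        using step[rule_format, of "Some a"] by (auto simp: ord_succ_def)
    qed
    have "P None"
      using step[rule_format, of None] S by (auto simp: ord_succ_def)
    with S show "P x"
      by (cases x) auto
  qed
  ultimately show ?thesis
    by (simp add: well_order_on_def)
qed


section \<open>Box products and the nabla quotient\<close>

definition box_power :: "'a topology \<Rightarrow> (nat \<Rightarrow> 'a) topology"
  where "box_power X =
    topology (arbitrary union_of (\<lambda>B. \<exists>U. (\<forall>n. openin X (U n)) \<and> B = Pi UNIV U))"

lemma openin_box_power:
  "openin (box_power X) = arbitrary union_of (\<lambda>B. \<exists>U. (\<forall>n. openin X (U n)) \<and> B = Pi UNIV U)"
proof -
  let ?P = "\<lambda>B. \<exists>U. (\<forall>n. openin X (U n)) \<and> B = Pi UNIV U"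
  have "?P (S \<inter> T)" if S: "?P S" and T: "?P T" for S T
  proof -
    obtain U V where "\<forall>n. openin X (U n)" "S = Pi UNIV U" "\<forall>n. openin X (V n)" "T = Pi UNIV V"
      using S T by auto
    then show ?thesis
      by (intro exI[of _ "\<lambda>n. U n \<inter> V n"]) auto
  qed
  then have "istopology (arbitrary union_of ?P)"
    by (intro istopology_base) blast
  then show ?thesis
    unfolding box_power_def by (rule topology_inverse')
qed

lemma topspace_box_power: "topspace (box_power X) = {x. \<forall>n. x n \<in> topspace X}"
proof
  show "topspace (box_power X) \<subseteq> {x. \<forall>n. x n \<in> topspace X}"
  proof
    fix x assume "x \<in> topspace (box_power X)"
    then obtain S where "openin (box_power X) S" "x \<in> S"
      by blast
    then obtain U where "\<forall>n. openin X (U n)" "x \<in> Pi UNIV U"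
      unfolding openin_box_power union_of_def by auto
    then show "x \<in> {x. \<forall>n. x n \<in> topspace X}"
      using openin_subset by fastforce
  qed
  have "openin (box_power X) (Pi UNIV (\<lambda>n. topspace X))"
    unfolding openin_box_power by (rule arbitrary_union_of_inc) auto
  moreover have "Pi UNIV (\<lambda>n. topspace X) = {x. \<forall>n. x n \<in> topspace X}"
    by auto
  ultimately show "{x. \<forall>n. x n \<in> topspace X} \<subseteq> topspace (box_power X)"
    by (metis openin_subset)
qed

definition almost_eq :: "'a topology \<Rightarrow> (nat \<Rightarrow> 'a) rel"
  where "almost_eq X =
    {(x, y). x \<in> topspace (box_power X) \<and> y \<in> topspace (box_power X) \<and> finite {n. x n \<noteq> y n}}"

lemma equiv_almost_eq: "equiv (topspace (box_power X)) (almost_eq X)"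
proof -
  have *: "finite {n. x n \<noteq> z n}" if "finite {n. x n \<noteq> y n}" "finite {n. y n \<noteq> z n}"
    for x y z :: "nat \<Rightarrow> 'a"
    by (rule finite_subset[OF _ finite_UnI[OF that]]) auto
  have "sym (almost_eq X)"
    by (rule symI) (simp add: almost_eq_def eq_commute)
  moreover have "trans (almost_eq X)"
    by (rule transI) (auto simp: almost_eq_def intro: *)
  ultimately show ?thesis
    by (auto simp: almost_eq_def equiv_def refl_on_def)
qed

text \<open>For a set \<open>W\<close> of equivalence classes, \<open>\<Union>W\<close> is its preimage under the
  canonical projection.\<close>

definition quotient_space :: "'a topology \<Rightarrow> 'a rel \<Rightarrow> 'a set topology"
  where "quotient_space X R = topology (\<lambda>W. W \<subseteq> topspace X // R \<and> openin X (\<Union>W))"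

lemma openin_quotient_space:
  assumes R: "equiv (topspace X) R"
  shows "openin (quotient_space X R) W \<longleftrightarrow> W \<subseteq> topspace X // R \<and> openin X (\<Union>W)"
proof -
  have int: "\<Union>(S \<inter> T) = \<Union>S \<inter> \<Union>T" if "S \<subseteq> topspace X // R" "T \<subseteq> topspace X // R" for S T
    using that quotient_disj[OF R] by blast
  have un: "\<Union>(\<Union>K) = \<Union>(Union ` K)" for K :: "'a set set set"
    by auto
  have "istopology (\<lambda>W. W \<subseteq> topspace X // R \<and> openin X (\<Union>W))"
    unfolding istopology_def
  proof (intro conjI allI impI)
    fix S T assume "S \<subseteq> topspace X // R \<and> openin X (\<Union>S)" "T \<subseteq> topspace X // R \<and> openin X (\<Union>T)"
    then show "openin X (\<Union>(S \<inter> T))"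
      using int[of S T] by auto
  next
    fix K assume "\<forall>S\<in>K. S \<subseteq> topspace X // R \<and> openin X (\<Union>S)"
    then show "openin X (\<Union>(\<Union>K))"
      unfolding un by (intro openin_Union) auto
  qed blast+
  then show ?thesis
    by (simp add: quotient_space_def)
qed

lemma topspace_quotient_space:
  assumes R: "equiv (topspace X) R"
  shows "topspace (quotient_space X R) = topspace X // R"
proof
  show "topspace (quotient_space X R) \<subseteq> topspace X // R"
    using openin_topspace[of "quotient_space X R"] openin_quotient_space[OF R] by blast
  have "openin (quotient_space X R) (topspace X // R)"
    by (simp add: openin_quotient_space[OF R] Union_quotient[OF R])
  then show "topspace X // R \<subseteq> topspace (quotient_space X R)"
    by (rule openin_subset)
qed

lemma quotient_map_quotient_space:
  assumes R: "equiv (topspace X) R"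
  shows "quotient_map X (quotient_space X R) (\<lambda>x. R `` {x})"
proof -
  have "{x \<in> topspace X. R `` {x} \<in> W} = \<Union>W" if W: "W \<subseteq> topspace X // R" for W
  proof (intro equalityI subsetI)
    fix x assume "x \<in> {x \<in> topspace X. R `` {x} \<in> W}"
    then show "x \<in> \<Union>W"
      using equiv_class_self[OF R] by blast
  next
    fix x assume "x \<in> \<Union>W"
    then obtain C where C: "C \<in> W" "x \<in> C"
      by blast
    then obtain y where y: "C = R `` {y}"
      using W by (auto elim: quotientE)
    then have "(y, x) \<in> R"
      using C by blast
    then have "R `` {y} = R `` {x}" "x \<in> topspace X"
      using equiv_class_eq_iff[OF R, of y x] by blast+
    then show "x \<in> {x \<in> topspace X. R `` {x} \<in> W}"
      using C y by simp
  qed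
  then show ?thesis
    by (auto simp: quotient_map_def topspace_quotient_space[OF R] openin_quotient_space[OF R]
        quotient_def)
qed

definition nabla_power :: "'a topology \<Rightarrow> (nat \<Rightarrow> 'a) set topology"
  where "nabla_power X = quotient_space (box_power X) (almost_eq X)"

end

theory Submission
  imports Defs "HOL-Library.Countable_Set_Type"
begin

unbundle cardinal_syntax

text \<open>
  Write \<open>p(a, b)\<close> for the class of the sequence \<open>a, b, a, b, \<dots>\<close>. On these classes a
  neighbourhood imposes only countably many constraints on \<open>a\<close> and \<open>b\<close>, so around a value of
  uncountable cofinality it still contains a whole interval. Hence the Tychonoff plank
  argument works one cardinal higher: the edges
  \<open>{p(\<omega>\<^sub>1, b) | b < \<omega>\<^sub>2}\<close> and \<open>{p(a, \<omega>\<^sub>2) | a < \<omega>\<^sub>1}\<close> are separated, but an open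
  set containing the second edge contains \<open>p(a, b)\<close> for all \<open>a < \<omega>\<^sub>1\<close> and all large \<open>b\<close>,
  and therefore accumulates at the first edge.
\<close>

section \<open>Neighbourhoods in the order topology and in the nabla quotient\<close>

text \<open>By induction on how the open set is generated, it contains some interval
  \<open>(b, q]\<close>. An upper ray \<open>aboveS r c\<close> yields \<open>b = c\<close>; for a
  lower ray or the whole field any point below \<open>q\<close> serves; an intersection takes the
  larger of the two bounds.\<close>

lemma openin_order_topology_of_interval:
  assumes r: "Linear_order r" and "openin (order_topology_of r) W" and "q \<in> W"
    and "underS r q \<noteq> {}"
  shows "\<exists>b\<in>underS r q. \<forall>y\<in>aboveS r b. (y, q) \<in> r \<longrightarrow> y \<in> W"
proof -
  have tr: "(a, c) \<in> r" if "(a, b) \<in> r" "(b, c) \<in> r" for a b c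
    using r that unfolding order_on_defs trans_def by blast
  have anti: "a = b" if "(a, b) \<in> r" "(b, a) \<in> r" for a b
    using r that unfolding order_on_defs antisym_def by blast
  have tot: "(a, b) \<in> r \<or> (b, a) \<in> r" if "a \<in> Field r" "b \<in> Field r" for a b
    using r that unfolding order_on_defs total_on_def refl_on_def by (cases "a = b") auto
  have "generate_topology_on (insert (Field r) (underS r ` Field r \<union> aboveS r ` Field r)) W"
    using assms(2) unfolding order_topology_of_def by (rule openin_topology_generated_by)
  then show ?thesis
    using assms(3)
  proof induction
    case Empty
    then show ?case by simp
  next
    case (Int A B)
    then obtain a b where a: "a \<in> underS r q" "\<forall>y\<in>aboveS r a. (y, q) \<in> r \<longrightarrow> y \<in> A"
      and b: "b \<in> underS r q" "\<forall>y\<in>aboveS r b. (y, q) \<in> r \<longrightarrow> y \<in> B"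
      by auto
    have "a \<in> Field r" "b \<in> Field r"
      using a(1) b(1) by (auto simp: underS_def Field_def)
    then consider "(a, b) \<in> r" | "(b, a) \<in> r"
      using tot by blast
    then show ?case
    proof cases
      case 1
      then have "aboveS r b \<subseteq> aboveS r a"
        by (auto simp: aboveS_def intro: tr dest: anti)
      then show ?thesis
        using a b by blast
    next
      case 2
      then have "aboveS r a \<subseteq> aboveS r b"
        by (auto simp: aboveS_def intro: tr dest: anti)
      then show ?thesis
        using a b by blast
    qed
  next
    case (UN K)
    then show ?case by blast
  next
    case (Basis S)
    then consider "S = Field r" | c where "S = underS r c" | c where "S = aboveS r c"
      by blast
    then show ?case
    proof cases
      case 1
      then show ?thesis
        using assms(4) by (auto simp: aboveS_def Field_def)
    next
      case 2
      then show ?thesis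
        using Basis(2) assms(4) by (auto simp: underS_def intro: tr dest: anti)
    next
      case 3
      then show ?thesis
        using Basis(2) by (auto simp: underS_def aboveS_def)
    qed
  qed
qed

text \<open>The preimage \<Union>V is open in the box topology and so contains a box around
  \<open>x\<close>. Distinct classes are disjoint, so the class of any point of \<Union>V is itself
  a member of \<open>V\<close>.\<close>

lemma openin_nabla_power_box:
  assumes V: "openin (nabla_power X) V" and x: "almost_eq X `` {x} \<in> V"
    and "x \<in> topspace (box_power X)"
  shows "\<exists>U. (\<forall>n. openin X (U n)) \<and> x \<in> Pi UNIV U \<and> (\<forall>y\<in>Pi UNIV U. almost_eq X `` {y} \<in> V)"
proof -
  note eq = equiv_almost_eq[of X]
  have V': "V \<subseteq> topspace (box_power X) // almost_eq X" "openin (box_power X) (\<Union>V)"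
    using V unfolding nabla_power_def openin_quotient_space[OF eq] by auto
  have "x \<in> \<Union>V"
    using x equiv_class_self[OF eq assms(3)] by blast
  moreover obtain K where K: "K \<subseteq> {B. \<exists>U. (\<forall>n. openin X (U n)) \<and> B = Pi UNIV U}" "\<Union>K = \<Union>V"
    using V'(2) unfolding openin_box_power union_of_def by (elim exE conjE)
  ultimately obtain B where B: "B \<in> K" "x \<in> B"
    by (metis UnionE)
  then obtain U where U: "\<forall>n. openin X (U n)" "B = Pi UNIV U"
    using K(1) by (auto dest!: subsetD)
  have sub: "Pi UNIV U \<subseteq> \<Union>V"
    using B(1) U(2) K(2) by (metis Union_upper)
  have "almost_eq X `` {y} \<in> V" if y: "y \<in> Pi UNIV U" for y
  proof -
    obtain C where C: "C \<in> V" "y \<in> C"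
      using sub y by blast
    then obtain z where z: "C = almost_eq X `` {z}"
      using V'(1) by (auto elim: quotientE)
    then have "almost_eq X `` {z} = almost_eq X `` {y}"
      using C(2) equiv_class_eq[OF eq] by blast
    then show ?thesis
      using C z by simp
  qed
  then show ?thesis
    using U B(2) by (intro exI[of _ U]) auto
qed

text \<open>Allowing finitely many exceptions makes the condition independent of the representative.
  With \<open>I\<close> the even or the odd indices, these sets witness that the two edges of the
  plank are separated.\<close>

definition nabla_eventually :: "'a topology \<Rightarrow> nat set \<Rightarrow> 'a set \<Rightarrow> (nat \<Rightarrow> 'a) set set"
  where "nabla_eventually X I G =
    (\<lambda>x. almost_eq X `` {x}) ` {x \<in> topspace (box_power X). finite {n \<in> I. x n \<notin> G}}"

lemma nabla_eventually:
  assumes G: "openin X G"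
  shows openin_nabla_eventually: "openin (nabla_power X) (nabla_eventually X I G)"
    and in_nabla_eventually_iff: "x \<in> topspace (box_power X) \<Longrightarrow>
      almost_eq X `` {x} \<in> nabla_eventually X I G \<longleftrightarrow> finite {n \<in> I. x n \<notin> G}"
proof -
  define T where "T = {x \<in> topspace (box_power X). finite {n \<in> I. x n \<notin> G}}"
  have img: "nabla_eventually X I G = (\<lambda>x. almost_eq X `` {x}) ` T"
    by (simp add: nabla_eventually_def T_def)
  note eq = equiv_almost_eq[of X]
  have sat: "y \<in> T" if "x \<in> T" "(x, y) \<in> almost_eq X" for x y
  proof -
    have "finite ({n \<in> I. x n \<notin> G} \<union> {n. x n \<noteq> y n})"
      using that by (auto simp: T_def almost_eq_def)
    then have "finite {n \<in> I. y n \<notin> G}"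
      by (rule finite_subset[rotated]) auto
    then show ?thesis
      using that by (auto simp: T_def almost_eq_def)
  qed
  have T: "T \<subseteq> topspace (box_power X)"
    by (auto simp: T_def)
  have Un: "\<Union>((\<lambda>x. almost_eq X `` {x}) ` T) = T"
    using sat equiv_class_self[OF eq] T by blast
  have "openin (box_power X) T"
  proof (subst openin_subopen, intro ballI)
    fix x assume x: "x \<in> T"
    \<comment> \<open>The box asks for \<open>G\<close> only where \<open>x\<close> already
      satisfies it, so the exceptions of any point of the box are among the finitely many exceptions
      of \<open>x\<close>.\<close>
    define U where "U n = (if n \<in> I \<and> x n \<in> G then G else topspace X)" for n
    have "openin (box_power X) (Pi UNIV U)"
      unfolding openin_box_power by (rule arbitrary_union_of_inc, rule exI[of _ U]) (auto simp: U_def G)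
    moreover have "x \<in> Pi UNIV U"
      using x by (auto simp: U_def T_def topspace_box_power)
    moreover have "Pi UNIV U \<subseteq> T"
    proof
      fix y assume y: "y \<in> Pi UNIV U"
      then have *: "y n \<in> U n" for n
        by auto
      have "{n \<in> I. y n \<notin> G} \<subseteq> {n \<in> I. x n \<notin> G}"
      proof (intro subsetI, clarify)
        fix n assume "n \<in> I" "y n \<notin> G" "x n \<in> G"
        then show False
          using *[of n] by (simp add: U_def)
      qed
      then have "finite {n \<in> I. y n \<notin> G}"
        by (rule finite_subset) (use x in \<open>simp add: T_def\<close>)
      moreover have "y n \<in> topspace X" for n
        using *[of n] openin_subset[OF G] by (auto simp: U_def split: if_splits)
      ultimately show "y \<in> T"
        by (simp add: T_def topspace_box_power)
    qed
    ultimately show "\<exists>S. openin (box_power X) S \<and> x \<in> S \<and> S \<subseteq> T"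
      by blast
  qed
  then show "openin (nabla_power X) (nabla_eventually X I G)"
    unfolding img nabla_power_def openin_quotient_space[OF eq] Un
    using T by (auto simp: quotient_def)
  assume x: "x \<in> topspace (box_power X)"
  then have "almost_eq X `` {x} \<in> nabla_eventually X I G \<longleftrightarrow> x \<in> T"
    unfolding img using Un equiv_class_self[OF eq x] by blast
  then show "almost_eq X `` {x} \<in> nabla_eventually X I G \<longleftrightarrow> finite {n \<in> I. x n \<notin> G}"
    using x by (simp add: T_def)
qed

text \<open>Each of the two values occurs infinitely often, so both can be recovered from the class
  modulo finite changes.\<close>

definition alternating :: "'a \<Rightarrow> 'a \<Rightarrow> nat \<Rightarrow> 'a"
  where "alternating a b n = (if even n then a else b)"

lemma finite_alternating_iff:
  "finite {n \<in> Collect even. alternating a b n \<notin> G} \<longleftrightarrow> a \<in> G"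
  "finite {n \<in> Collect odd. alternating a b n \<notin> G} \<longleftrightarrow> b \<in> G"
proof -
  have "infinite (range (\<lambda>n::nat. 2 * n))" "infinite (range (\<lambda>n::nat. 2 * n + 1))"
    by (intro range_inj_infinite injI; simp)+
  moreover have "range (\<lambda>n::nat. 2 * n) = {n. even n}" "range (\<lambda>n::nat. 2 * n + 1) = {n. odd n}"
    by (auto elim: evenE oddE)
  ultimately have "infinite {n::nat. even n}" "infinite {n::nat. odd n}"
    by simp_all
  moreover have "{n \<in> Collect even. alternating a b n \<notin> G} = (if a \<in> G then {} else {n. even n})"
    "{n \<in> Collect odd. alternating a b n \<notin> G} = (if b \<in> G then {} else {n. odd n})"
    by (auto simp: alternating_def)
  ultimately show "finite {n \<in> Collect even. alternating a b n \<notin> G} \<longleftrightarrow> a \<in> G"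
    "finite {n \<in> Collect odd. alternating a b n \<notin> G} \<longleftrightarrow> b \<in> G"
    by simp_all
qed

section \<open>The plank argument over a linear order\<close>

text \<open>The points \<open>p\<close> and \<open>q\<close> play the roles of
  \<open>\<omega>\<^sub>1\<close> and \<open>\<omega>\<^sub>2\<close>: the cofinality of
  \<open>p\<close> is uncountable, and that of \<open>q\<close> exceeds the number of points below
  \<open>p\<close>. The sets \<open>E\<close> and \<open>D\<close> in the proof are the edges of the
  plank.\<close>

theorem not_hereditarily_normal_nabla_power:
  fixes r :: "'a rel"
  assumes r: "Linear_order r" and pq: "p \<in> Field r" "q \<in> Field r"
    and inf: "infinite (underS r p)"
    and bdd_p: "\<And>A. A \<subseteq> underS r p \<Longrightarrow> countable A \<Longrightarrow> \<exists>c\<in>underS r p. A \<subseteq> underS r c"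
    and bdd_q: "\<And>A. A \<subseteq> underS r q \<Longrightarrow> |A| \<le>o |underS r p| \<Longrightarrow> \<exists>c\<in>underS r q. A \<subseteq> underS r c"
  shows "\<not> hereditarily normal_space (nabla_power (order_topology_of r))"
proof
  define X where "X = order_topology_of r"
  define P where "P a b = almost_eq X `` {alternating a b}" for a b
  define E where "E = {P p b | b. b \<in> underS r q}"
  define D where "D = {P a q | a. a \<in> underS r p}"
  have F: "underS r c \<subseteq> Field r" for c
    by (auto simp: underS_def Field_def)
  \<comment> \<open>A countable set is no larger than the infinite set \<open>underS r p\<close>, so
    \<open>bdd_q\<close> covers it.\<close>
  have bdd_q': "\<exists>c\<in>underS r q. A \<subseteq> underS r c" if "A \<subseteq> underS r q" "countable A" for A
  proof (rule bdd_q[OF that(1)])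
    show "|A| \<le>o |underS r p|"
      using that(2) inf unfolding countable_card_of_nat infinite_iff_card_of_nat
      by (rule ordLeq_transitive)
  qed
  have alt: "alternating a b \<in> topspace (box_power X)" if "a \<in> Field r" "b \<in> Field r" for a b
    using that by (simp add: topspace_box_power X_def alternating_def)
  have ray: "openin X (underS r c)" if "c \<in> Field r" for c
    unfolding X_def order_topology_of_def by (rule topology_generated_by_Basis) (use that in auto)
  have interval: "\<exists>b\<in>underS r c. \<forall>y\<in>aboveS r b. (y, c) \<in> r \<longrightarrow> y \<in> U"
    if "openin X U" "c \<in> U" "underS r c \<noteq> {}" for U c
    using openin_order_topology_of_interval[OF r _ that(2,3)] that(1) by (simp add: X_def)
  \<comment> \<open>Bounding the empty set already produces a point below \<open>p\<close> and one
    below \<open>q\<close>.\<close>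
  have ne: "underS r p \<noteq> {}" "underS r q \<noteq> {}"
    using bdd_p[of "{}"] bdd_q'[of "{}"] by auto
  assume "hereditarily normal_space (nabla_power (order_topology_of r))"
  then have norm: "\<And>S T. separatedin (nabla_power X) S T \<Longrightarrow>
      \<exists>U V. openin (nabla_power X) U \<and> openin (nabla_power X) V \<and> S \<subseteq> U \<and> T \<subseteq> V \<and> disjnt U V"
    by (simp add: hereditarily_normal_separation X_def)
  have sep: "separatedin (nabla_power X) E D"
  proof -
    \<comment> \<open>The odd coordinates tell the edges apart through \<open>q\<close>, the even
      ones through \<open>p\<close>: \<open>G\<close> contains \<open>E\<close> and misses
      \<open>D\<close>, while \<open>H\<close> contains \<open>D\<close> and misses
      \<open>E\<close>. An open set that misses a set also misses its closure.\<close>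
    define G where "G = nabla_eventually X (Collect odd) (underS r q)"
    define H where "H = nabla_eventually X (Collect even) (underS r p)"
    have mem: "P a b \<in> G \<longleftrightarrow> b \<in> underS r q" "P a b \<in> H \<longleftrightarrow> a \<in> underS r p"
      if "a \<in> Field r" "b \<in> Field r" for a b
      using in_nabla_eventually_iff[OF ray alt[OF that]] pq
      unfolding P_def G_def H_def by (simp_all only: finite_alternating_iff)
    have open_G: "openin (nabla_power X) G" and open_H: "openin (nabla_power X) H"
      unfolding G_def H_def by (intro openin_nabla_eventually ray pq)+
    have irr: "c \<notin> underS r c" for c
      by (simp add: underS_def)
    have E: "E \<subseteq> G" "H \<inter> E = {}"
      using mem(1)[OF pq(1)] mem(2)[OF pq(1)] F irr by (auto simp: E_def)
    have D: "D \<subseteq> H" "G \<inter> D = {}"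
      using mem(1)[OF _ pq(2)] mem(2)[OF _ pq(2)] F irr by (auto simp: D_def)
    have "G \<inter> nabla_power X closure_of D = {}" "H \<inter> nabla_power X closure_of E = {}"
      using D(2) E(2) openin_Int_closure_of_eq_empty[OF open_G]
        openin_Int_closure_of_eq_empty[OF open_H] by simp_all
    moreover have "E \<subseteq> topspace (nabla_power X)" "D \<subseteq> topspace (nabla_power X)"
      using E(1) D(1) openin_subset[OF open_G] openin_subset[OF open_H] by simp_all
    ultimately show ?thesis
      using E(1) D(1) unfolding separatedin_def by blast
  qed
  obtain U V where UV: "openin (nabla_power X) U" "openin (nabla_power X) V" "E \<subseteq> U" "D \<subseteq> V"
    "disjnt U V"
    using norm[OF sep] by (elim exE conjE)
  \<comment> \<open>Fix \<open>a\<close> and take a box around \<open>P a q\<close> inside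
    \<open>V\<close>. Each odd factor contains an interval \<open>(d n, q]\<close>, and countably
    many \<open>d n\<close> have a common bound \<open>c\<close> below \<open>q\<close>; the even
    coordinates keep the value \<open>a\<close>.\<close>
  have "\<exists>c\<in>underS r q. \<forall>b\<in>underS r q \<inter> aboveS r c. P a b \<in> V" if a: "a \<in> underS r p" for a
  proof -
    have aF: "a \<in> Field r"
      using a F by blast
    have PV: "P a q \<in> V"
      using a UV(4) by (auto simp: D_def)
    obtain W where W: "\<forall>n. openin X (W n)" "alternating a q \<in> Pi UNIV W"
      "\<forall>y\<in>Pi UNIV W. almost_eq X `` {y} \<in> V"
      using openin_nabla_power_box[OF UV(2) PV[unfolded P_def] alt[OF aF pq(2)]]
      by (elim exE conjE)
    have "\<exists>d\<in>underS r q. \<forall>y\<in>aboveS r d. (y, q) \<in> r \<longrightarrow> y \<in> W n" if "odd n" for n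
      by (rule interval) (use W(1) Pi_mem[OF W(2), of n] that ne in \<open>auto simp: alternating_def\<close>)
    then obtain d where d: "\<And>n. odd n \<Longrightarrow> d n \<in> underS r q"
      "\<And>n y. odd n \<Longrightarrow> y \<in> aboveS r (d n) \<Longrightarrow> (y, q) \<in> r \<Longrightarrow> y \<in> W n"
      by metis
    obtain c where c: "c \<in> underS r q" "d ` Collect odd \<subseteq> underS r c"
      using bdd_q'[of "d ` Collect odd"] d(1) by auto
    have "P a b \<in> V" if b: "b \<in> underS r q" "b \<in> aboveS r c" for b
    proof -
      have "alternating a b n \<in> W n" for n
      proof (cases "even n")
        case True
        then show ?thesis
          using Pi_mem[OF W(2), of n] by (simp add: alternating_def)
      next
        case False
        then have "d n \<in> underS r c"
          using c(2) by auto
        then have "b \<in> aboveS r (d n)"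
          using b(2) r unfolding order_on_defs underS_def aboveS_def trans_def antisym_def by blast
        then show ?thesis
          using d(2)[OF False] False b(1) by (simp add: alternating_def underS_def)
      qed
      then show ?thesis
        unfolding P_def by (intro W(3)[rule_format]) auto
    qed
    then show ?thesis
      using c(1) by blast
  qed
  then obtain g where g: "\<And>a. a \<in> underS r p \<Longrightarrow> g a \<in> underS r q"
    "\<And>a b. a \<in> underS r p \<Longrightarrow> b \<in> underS r q \<Longrightarrow> b \<in> aboveS r (g a) \<Longrightarrow> P a b \<in> V"
    by (metis IntI)
  \<comment> \<open>There is one threshold \<open>g a\<close> for each \<open>a\<close> below
    \<open>p\<close>, so by \<open>bdd_q\<close> a single \<open>b\<close> below \<open>q\<close>
    exceeds them all.\<close>
  obtain b where b: "b \<in> underS r q" "g ` underS r p \<subseteq> underS r b"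
    using bdd_q[of "g ` underS r p"] g(1) card_of_image by blast
  have V: "P a b \<in> V" if "a \<in> underS r p" for a
    using g(2)[OF that b(1)] b(2) that by (auto simp: underS_def aboveS_def)
  have bF: "b \<in> Field r"
    using b(1) F by blast
  have PU: "P p b \<in> U"
    using b(1) UV(3) by (auto simp: E_def)
  obtain W where W: "\<forall>n. openin X (W n)" "alternating p b \<in> Pi UNIV W"
    "\<forall>y\<in>Pi UNIV W. almost_eq X `` {y} \<in> U"
    using openin_nabla_power_box[OF UV(1) PU[unfolded P_def] alt[OF pq(1) bF]]
    by (elim exE conjE)
  \<comment> \<open>The same argument at \<open>P p b\<close>, now on the even coordinates: a
    suitable \<open>a\<close> below \<open>p\<close> puts \<open>P a b\<close> into
    \<open>U\<close>, although it already lies in \<open>V\<close>.\<close>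
  have "\<exists>d\<in>underS r p. \<forall>y\<in>aboveS r d. (y, p) \<in> r \<longrightarrow> y \<in> W n" if "even n" for n
    by (rule interval) (use W(1) Pi_mem[OF W(2), of n] that ne in \<open>auto simp: alternating_def\<close>)
  then obtain d where d: "\<And>n. even n \<Longrightarrow> d n \<in> underS r p"
    "\<And>n y. even n \<Longrightarrow> y \<in> aboveS r (d n) \<Longrightarrow> (y, p) \<in> r \<Longrightarrow> y \<in> W n"
    by metis
  obtain a where a: "a \<in> underS r p" "d ` Collect even \<subseteq> underS r a"
    using bdd_p[of "d ` Collect even"] d(1) by auto
  have "alternating a b n \<in> W n" for n
  proof (cases "even n")
    case True
    then have "a \<in> aboveS r (d n)"
      using a(2) by (auto simp: underS_def aboveS_def)
    then show ?thesis
      using d(2)[OF True] True a(1) by (simp add: alternating_def underS_def)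
  next
    case False
    then show ?thesis
      using Pi_mem[OF W(2), of n] by (simp add: alternating_def)
  qed
  then have "P a b \<in> U"
    unfolding P_def by (intro W(3)[rule_format]) auto
  then show False
    using V[OF a(1)] UV(5) by (auto simp: disjnt_def)
qed

section \<open>Bounded sets and initial segments of \<open>omega2\<close>\<close>

text \<open>In a linear order, a point outside all the closed initial segments given by
  \<open>A\<close> lies strictly above every element of \<open>A\<close>. Boundedness thus becomes a
  matter of counting.\<close>

lemma exists_strict_upper_bound:
  assumes r: "Linear_order r" and "A \<subseteq> Field r" "B \<subseteq> Field r"
    and "\<not> B \<subseteq> (\<Union>a\<in>A. insert a (underS r a))"
  shows "\<exists>c\<in>B. A \<subseteq> underS r c"
proof -
  obtain c where c: "c \<in> B" "c \<notin> (\<Union>a\<in>A. insert a (underS r a))"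
    using assms(4) by blast
  have "a \<in> underS r c" if "a \<in> A" for a
  proof -
    have "a \<noteq> c" "(c, a) \<notin> r" "a \<in> Field r" "c \<in> Field r"
      using c that assms by (auto simp: underS_def)
    then show ?thesis
      using r unfolding order_on_defs total_on_def underS_def by blast
  qed
  then show ?thesis
    using c(1) by blast
qed

text \<open>This locates \<open>\<omega>\<^sub>1\<close> as a point of \<open>omega2\<close>, since
  \<open>omega1\<close> lives on a different type. As \<open>omega1\<close> is smaller than
  \<open>omega2\<close>, it is isomorphic to a proper initial segment, which is uncountable;
  well-foundedness then gives the least such point.\<close>

lemma exists_least_uncountable_initial_segment:
  "\<exists>w\<in>Field omega2. uncountable (underS omega2 w) \<and> (\<forall>a\<in>underS omega2 w. countable (underS omega2 a))"
proof -
  have wo: "Well_order omega2"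
    using Card_order_omega2(2) by (rule card_order_on_well_order_on)
  obtain v where v: "v \<in> Field omega2" "omega1 =o Restr omega2 (underS omega2 v)"
    using less_omega2(2) ordLess_iff_ordIso_Restr[OF wo]
      card_order_on_well_order_on[OF Card_order_omega2(1)] by blast
  have "uncountable (underS omega2 v)"
  proof
    assume "countable (underS omega2 v)"
    then have "|underS omega2 v| \<le>o natLeq"
      by (simp add: countable_card_le_natLeq)
    moreover have "Field (Restr omega2 (underS omega2 v)) = underS omega2 v"
      using wo by (simp add: Field_Restr_ofilter wo_rel.underS_ofilter wo_rel_def)
    then have "|Field omega1| =o |underS omega2 v|"
      using card_of_cong[OF v(2)] by simp
    moreover have "omega1 =o |Field omega1|"
      using Card_order_omega2(1) card_of_Field_ordIso ordIso_symmetric by blast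
    ultimately have "omega1 \<le>o natLeq"
      by (blast intro: ordIso_ordLeq_trans)
    then show False
      using less_omega2(1) not_ordLess_ordLeq by blast
  qed
  moreover have "wf (omega2 - Id)"
    using wo by (simp add: well_order_on_def)
  ultimately obtain w where "w \<in> {w \<in> Field omega2. uncountable (underS omega2 w)}"
    "\<And>a. (a, w) \<in> omega2 - Id \<Longrightarrow> a \<notin> {w \<in> Field omega2. uncountable (underS omega2 w)}"
    using v(1) wfE_min[of "omega2 - Id" v "{w \<in> Field omega2. uncountable (underS omega2 w)}" thesis]
    by simp
  then show ?thesis
    by (intro bexI[of _ w]) (auto simp: underS_def Field_def)
qed

lemma card_of_subset_omega2_ordLeq:
  assumes "|A| <o omega2"
  shows "|A| \<le>o omega1"
  using assms cardSuc_ordLeq_ordLess[OF Card_order_omega2(1) card_of_Card_order, of A]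
  by (simp add: omega2_def)

lemma infinite_Field_omega1: "infinite (Field omega1)"
proof -
  have "|Field natLeq| \<le>o |Field omega1|"
    using less_omega2(1) by (intro card_of_mono2 ordLess_imp_ordLeq)
  then show ?thesis
    using card_of_ordLeq_finite infinite_UNIV_nat unfolding Field_natLeq by blast
qed

lemma underS_ord_succ:
  "underS (ord_succ r) None = Some ` Field r"
  "underS (ord_succ r) (Some w) = Some ` underS r w"
  by (auto simp: underS_def ord_succ_def)

section \<open>Application to \<open>\<omega>\<^sub>2 + 1\<close>\<close>

theorem theorem34:
  shows "\<not> hereditarily normal_space (nabla_power (order_topology_of (ord_succ omega2)))"
proof -
  have wo: "Well_order omega2"
    using Card_order_omega2(2) by (rule card_order_on_well_order_on)
  then have lin: "Linear_order omega2"
    by (simp add: well_order_on_def)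
  obtain w where w: "w \<in> Field omega2" "uncountable (underS omega2 w)"
    and least: "\<And>a. a \<in> underS omega2 w \<Longrightarrow> countable (underS omega2 a)"
    using exists_least_uncountable_initial_segment by blast
  have F: "underS omega2 a \<subseteq> Field omega2" for a
    by (auto simp: underS_def Field_def)
  \<comment> \<open>Uncountable cofinality of \<open>w\<close>: countably many countable segments
    cannot cover an uncountable one.\<close>
  have bdd_w: "\<exists>c\<in>underS omega2 w. A \<subseteq> underS omega2 c"
    if A: "A \<subseteq> underS omega2 w" "countable A" for A
  proof (rule exists_strict_upper_bound[OF lin])
    have "countable (\<Union>a\<in>A. insert a (underS omega2 a))"
      using A least by (intro countable_UN) auto
    then show "\<not> underS omega2 w \<subseteq> (\<Union>a\<in>A. insert a (underS omega2 a))"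
      using w(2) countable_subset by blast
  qed (use A F in auto)
  \<comment> \<open>Regularity of \<open>omega2\<close>: at most \<open>omega1\<close> many
    segments, each of size at most \<open>omega1\<close>, have a union of size at most
    \<open>omega1\<close> and so cannot exhaust the field.\<close>
  have bdd_top: "\<exists>c\<in>Field omega2. A \<subseteq> underS omega2 c"
    if A: "A \<subseteq> Field omega2" "|A| \<le>o omega1" for A
  proof (rule exists_strict_upper_bound[OF lin])
    have "|underS omega2 a| \<le>o omega1" if "a \<in> A" for a
      using that A by (intro card_of_subset_omega2_ordLeq card_of_underS Card_order_omega2) auto
    then have "|\<Union>a\<in>A. underS omega2 a| \<le>o omega1"
      by (intro card_of_UNION_ordLeq_infinite_Field infinite_Field_omega1 Card_order_omega2 A) auto
    then have "|A \<union> (\<Union>a\<in>A. underS omega2 a)| \<le>o omega1"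
      by (intro card_of_Un_ordLeq_infinite_Field infinite_Field_omega1 Card_order_omega2 A) auto
    moreover have "A \<union> (\<Union>a\<in>A. underS omega2 a) = (\<Union>a\<in>A. insert a (underS omega2 a))"
      by blast
    ultimately have le: "|\<Union>a\<in>A. insert a (underS omega2 a)| <o omega2"
      using less_omega2(2) by (metis ordLeq_ordLess_trans)
    show "\<not> Field omega2 \<subseteq> (\<Union>a\<in>A. insert a (underS omega2 a))"
    proof
      assume "Field omega2 \<subseteq> (\<Union>a\<in>A. insert a (underS omega2 a))"
      then have "|Field omega2| <o omega2"
        using le card_of_mono1 ordLeq_ordLess_trans by blast
      then show False
        using card_of_Field_ordIso[OF Card_order_omega2(2)] not_ordLess_ordIso by blast
    qed
  qed (use A in auto)
  have le_w: "|underS omega2 w| \<le>o omega1"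
    by (intro card_of_subset_omega2_ordLeq card_of_underS Card_order_omega2 w)
  show ?thesis
  \<comment> \<open>In the successor order, \<open>Some w\<close> is the point
    \<open>\<omega>\<^sub>1\<close> and \<open>None\<close> is the top point
    \<open>\<omega>\<^sub>2\<close>. The bounds found in \<open>omega2\<close> transfer along the
    injection \<open>Some\<close>.\<close>
  proof (rule not_hereditarily_normal_nabla_power[where p = "Some w" and q = None])
    show "Linear_order (ord_succ omega2)"
      using Well_order_ord_succ[OF wo] by (simp add: well_order_on_def)
    show "Some w \<in> Field (ord_succ omega2)" "None \<in> Field (ord_succ omega2)"
      using w by (auto simp: Field_ord_succ)
    show "infinite (underS (ord_succ omega2) (Some w))"
      using w(2) countable_finite by (auto simp: underS_ord_succ finite_image_iff)
  next
    fix A assume A: "A \<subseteq> underS (ord_succ omega2) (Some w)" "countable A"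
    then obtain B where B: "B \<subseteq> underS omega2 w" "A = Some ` B"
      by (auto simp: underS_ord_succ subset_image_iff)
    then have "countable B"
      using A(2) by (simp add: countable_image_inj_eq)
    then show "\<exists>c\<in>underS (ord_succ omega2) (Some w). A \<subseteq> underS (ord_succ omega2) c"
      using bdd_w[OF B(1)] B(2) by (auto simp: underS_ord_succ)
  next
    fix A assume A: "A \<subseteq> underS (ord_succ omega2) None" "|A| \<le>o |underS (ord_succ omega2) (Some w)|"
    then obtain B where B: "B \<subseteq> Field omega2" "A = Some ` B"
      by (auto simp: underS_ord_succ subset_image_iff)
    have "B = the ` A"
      using B(2) by (auto simp: image_image)
    then have "|B| \<le>o |A|"
      by (simp add: card_of_image)
    also have "|A| \<le>o |underS omega2 w|"
      using A(2) card_of_image ordLeq_transitive unfolding underS_ord_succ by blast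
    also note le_w
    finally have "|B| \<le>o omega1" .
    then show "\<exists>c\<in>underS (ord_succ omega2) None. A \<subseteq> underS (ord_succ omega2) c"
      using bdd_top[OF B(1)] B(2) by (auto simp: underS_ord_succ)
  qed
qed

end
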